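(* For each $n\in\{5,6,7\}$, the space $\mathrm{GST}_n=\mathrm{Ind}_n\cap\mathrm{Inf}_n\subset[0,1]^n$ is connected (in the subspace topology from $\mathbb{R}^n$).
   Context: Let $n\ge 3$. A symmetric $n$-player game with $n$ dichotomous causes $C_1,\dots,C_n$ (each of probability $1/2$) and $n$ dichotomous effects $E_1,\dots,E_n$ is encoded by a point $\mathbf{x}=(x_1,\dots,x_n)\in[0,1]^n$, where $x_s$ is the probability of the effect for a player when exactly $s$ players (including that player) have the same cause state as that player. Define $$\Psi(\mathbf{x})=\left(\frac{1}{2^{n-1}}\sum_{k=0}^{n-1}\binom{n-1}{k}x_{k+1}\right)^2-\frac{1}{2^{n-1}}\sum_{k=0}^{n-2}\binom{n-2}{k}\left(x_{k+2}^2+x_{k+1}x_{n-(k+1)}\right).$$ The independence space is $\mathrm{Ind}_n=\{\mathbf{x}\in[0,1]^n : \Psi(\mathbf{x})=0\}$ (this expresses $\mathbb{P}(E_i\wedge E_j\mid C_k)=\mathbb{P}(E_i\mid C_k)\mathbb{P}(E_j\mid C_k)$). The influence space is $\mathrm{Inf}_n=\{\mathbf{x}\in[0,1]^n : \text{there exists } s\in\{1,\dots,n\} \text{ with } x_s\ne x_{n-s+1}\}$ (this expresses that every cause influences every effect). Finally, $\mathrm{GST}_n=\mathrm{Ind}_n\cap\mathrm{Inf}_n$. *)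

theory Defs
  imports "HOL-Analysis.Analysis"
begin

(* A point (x_1, ..., x_n) of R^n is an extensional function on {1..n}, so that the
   coordinates keep the indices 1, ..., n; R^n itself is the product topology
   powertop_real {1..n}. *)

definition unit_cube :: "nat \<Rightarrow> (nat \<Rightarrow> real) set" where
  "unit_cube n = ({1..n} \<rightarrow>\<^sub>E {0..1})"

(* Only used for n >= 3. All subtractions on nat are then exact, and all coordinates
   that occur have indices in {1..n}. *)
definition Psi :: "nat \<Rightarrow> (nat \<Rightarrow> real) \<Rightarrow> real" where
  "Psi n x =
     (1 / 2 ^ (n - 1) * (\<Sum>k = 0..n - 1. real ((n - 1) choose k) * x (k + 1)))\<^sup>2
     - 1 / 2 ^ (n - 1) *
         (\<Sum>k = 0..n - 2. real ((n - 2) choose k) *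
            ((x (k + 2))\<^sup>2 + x (k + 1) * x (n - (k + 1))))"

definition Ind :: "nat \<Rightarrow> (nat \<Rightarrow> real) set" where
  "Ind n = {x \<in> unit_cube n. Psi n x = 0}"

definition Infl :: "nat \<Rightarrow> (nat \<Rightarrow> real) set" where
  "Infl n = {x \<in> unit_cube n. \<exists>s\<in>{1..n}. x s \<noteq> x (n - s + 1)}"

definition GST :: "nat \<Rightarrow> (nat \<Rightarrow> real) set" where
  "GST n = Ind n \<inter> Infl n"

end

theory Submission
  imports Defs
begin

text \<open>
  \<open>Psi\<close> is a quadratic form with the constants in its radical, so around the centre of the cube its
  zero set is a cone, and connectedness of \<open>GST\<close> reduces to that of the cone of non-symmetric null
  vectors. Fix a null vector \<open>e\<close> outside the radical of the polar form \<open>B\<close>. The null vectors \<open>y\<close>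
  with \<open>B e y > 0\<close> form a retract of a half-space, hence a connected set, and likewise for
  \<open>B e y < 0\<close>. A null vector \<open>y\<close> with \<open>B e y = 0\<close> is a limit of both pieces as soon as it is not
  proportional to \<open>e\<close> modulo the radical, so a single such vector glues the pieces together. It
  exists for \<open>n = 5, 6, 7\<close>, where the form has at least two positive and two negative squares.
\<close>

section \<open>Lines in the product space\<close>

lemma continuous_on_line: "continuous_on UNIV (\<lambda>t i. x i + t * y i :: real)"
  by (intro continuous_on_coordinatewise_then_product continuous_intros)

lemma ray_in_closure:
  fixes S :: "(nat \<Rightarrow> real) set"
  assumes "\<And>t. t > 0 \<Longrightarrow> (\<lambda>i. y i + t * v i) \<in> S"
  shows "y \<in> closure S"
proof -
  let ?l = "\<lambda>t i. y i + t * v i"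
  have "?l ` closure {0<..} \<subseteq> closure S"
    by (rule image_closure_subset[OF continuous_on_subset[OF continuous_on_line] closed_closure])
      (use assms closure_subset in auto)
  then have "?l 0 \<in> closure S" by (force simp: closure_greaterThan)
  then show ?thesis by simp
qed

section \<open>Null cone of a bilinear form with a chosen null vector\<close>

locale isotropic_form =
  fixes B :: "(nat \<Rightarrow> real) \<Rightarrow> (nat \<Rightarrow> real) \<Rightarrow> real" and e :: "nat \<Rightarrow> real"
  assumes sym: "B x y = B y x"
    and linear: "B (\<lambda>i. x i + t * y i) z = B x z + t * B y z"
    and continuous_form: "continuous_on UNIV (\<lambda>x. B x x)"
    and continuous_functional: "continuous_on UNIV (B e)"
    and isotropic: "B e e = 0"
    and nondegenerate: "\<exists>w. B e w \<noteq> 0"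
begin

lemma linear_right: "B z (\<lambda>i. x i + t * y i) = B z x + t * B z y"
  by (metis linear sym)

lemma form_add: "B (\<lambda>i. x i + t * y i) (\<lambda>i. x i + t * y i) = B x x + 2 * t * B x y + t\<^sup>2 * B y y"
  by (simp add: linear linear_right sym[of y x] power2_eq_square algebra_simps)

definition side :: "real \<Rightarrow> (nat \<Rightarrow> real) set" where
  "side \<sigma> = {y. B y y = 0 \<and> \<sigma> * B e y > 0}"

text \<open>Convexity: a linear functional is affine along the segment between two points.\<close>

lemma connected_half_space: "connected {y. \<sigma> * B e y > 0}"
  unfolding connected_iff_connected_component
proof (intro ballI)
  fix x y assume xy: "x \<in> {y. \<sigma> * B e y > 0}" "y \<in> {y. \<sigma> * B e y > 0}"
  define d where "d = (\<lambda>i. y i + (-1) * x i)"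
  let ?l = "\<lambda>t i. x i + t * d i"
  have "\<sigma> * B e (?l t) > 0" if "t \<in> {0..1}" for t
  proof -
    have eq: "\<sigma> * B e (?l t) = (1 - t) * (\<sigma> * B e x) + t * (\<sigma> * B e y)"
      unfolding linear_right d_def by (simp add: algebra_simps)
    show ?thesis
    proof (cases "t = 0")
      case False
      then have "t * (\<sigma> * B e y) > 0" using that xy by (intro mult_pos_pos[of t]) auto
      moreover have "(1 - t) * (\<sigma> * B e x) \<ge> 0"
        using that xy by (intro mult_nonneg_nonneg[of "1 - t"]) auto
      ultimately show ?thesis unfolding eq by linarith
    qed (use xy in simp)
  qed
  moreover have "connected (?l ` {0..1})"
    by (rule connected_continuous_image[OF continuous_on_subset[OF continuous_on_line]]) auto
  moreover have "x \<in> ?l ` {0..1}" "y \<in> ?l ` {0..1}"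
    by (rule image_eqI[of _ _ 0], simp_all) (rule image_eqI[of _ _ 1], simp_all add: d_def)
  ultimately show "connected_component {y. \<sigma> * B e y > 0} x y"
    unfolding connected_component_def by (intro exI[of _ "?l ` {0..1}"]) auto
qed

text \<open>Since \<open>e\<close> is null, the form is affine along lines parallel to \<open>e\<close>, so sliding along
  \<open>e\<close> retracts an open half-space bounded by the orthogonal complement of \<open>e\<close> onto the
  null vectors it contains.\<close>

lemma connected_side: "connected (side \<sigma>)"
proof -
  let ?r = "\<lambda>y i. y i + (- (B y y / (2 * B e y))) * e i"
  have fr: "B e (?r y) = B e y" for y by (simp only: linear_right isotropic)
  have "continuous_on {y. \<sigma> * B e y > 0} ?r"
    by (intro continuous_on_coordinatewise_then_product continuous_intros
        continuous_on_subset[OF continuous_form] continuous_on_subset[OF continuous_functional]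
        continuous_on_subset[OF continuous_on_product_coordinates] subset_UNIV) auto
  then have "connected (?r ` {y. \<sigma> * B e y > 0})"
    by (rule connected_continuous_image) (rule connected_half_space)
  moreover have "?r ` {y. \<sigma> * B e y > 0} = side \<sigma>"
  proof (intro equalityI subsetI)
    fix z assume "z \<in> ?r ` {y. \<sigma> * B e y > 0}"
    then obtain y where y: "z = ?r y" "\<sigma> * B e y > 0" by auto
    have "B z z = B y y + 2 * (- (B y y / (2 * B e y))) * B e y"
      unfolding y(1) form_add isotropic sym[of y e] by simp
    moreover have "B e y \<noteq> 0" using y(2) by auto
    ultimately have "B z z = 0" by simp
    then show "z \<in> side \<sigma>" using y fr[of y] by (simp add: side_def)
  next
    fix z assume z: "z \<in> side \<sigma>"
    then have "z = ?r z" by (simp add: side_def)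
    moreover have "z \<in> {y. \<sigma> * B e y > 0}" using z by (simp add: side_def)
    ultimately show "z \<in> ?r ` {y. \<sigma> * B e y > 0}" by (rule image_eqI[of z ?r z])
  qed
  ultimately show ?thesis by (simp only:)
qed

text \<open>Proportionality modulo the radical: \<open>y - c * e\<close> is orthogonal to
  everything.\<close>

definition proportional :: "(nat \<Rightarrow> real) \<Rightarrow> bool" where
  "proportional y \<longleftrightarrow> (\<exists>c. \<forall>w. B y w = c * B e w)"

text \<open>If the kernel of \<open>B y\<close> lies in that of \<open>B e\<close>, the two
  functionals are multiples of each other, by projecting along any \<open>w0\<close> with
  \<open>B e w0 \<noteq> 0\<close>.\<close>

lemma transversal_if_not_proportional:
  assumes "\<not> proportional y"
  shows "\<exists>w. B y w = 0 \<and> B e w \<noteq> 0"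
proof (rule ccontr)
  assume "\<not> ?thesis"
  then have ker: "B e w = 0" if "B y w = 0" for w using that by blast
  obtain w0 where w0: "B e w0 \<noteq> 0" using nondegenerate by blast
  then have y0: "B y w0 \<noteq> 0" using ker by blast
  have "B y w = (B y w0 / B e w0) * B e w" for w
  proof -
    have "B y (\<lambda>i. w i + (- (B y w / B y w0)) * w0 i) = 0"
      unfolding linear_right using y0 by simp
    then have "B e w + (- (B y w / B y w0)) * B e w0 = 0"
      using ker linear_right by metis
    then show ?thesis using w0 y0 by (simp add: field_simps)
  qed
  then show False using assms unfolding proportional_def by blast
qed

definition wall :: "(nat \<Rightarrow> real) set" where
  "wall = {y. B y y = 0 \<and> B e y = 0 \<and> \<not> proportional y}"

text \<open>A vector \<open>w\<close> orthogonal to \<open>y\<close> but not to \<open>e\<close>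
  becomes null after a correction along \<open>e\<close>, which changes neither \<open>B y w\<close>
  nor \<open>B e w\<close>. The line from \<open>y\<close> in the resulting direction
  \<open>v\<close> consists of null vectors and leaves the hyperplane
  \<open>B e y = 0\<close>.\<close>

lemma wall_subset_closure_side:
  assumes "\<sigma> \<noteq> 0"
  shows "wall \<subseteq> closure (side \<sigma>)"
proof
  fix y assume "y \<in> wall"
  then have y: "B y y = 0" "B e y = 0" "\<not> proportional y" by (auto simp: wall_def)
  obtain w where w: "B y w = 0" "B e w \<noteq> 0"
    using transversal_if_not_proportional[OF y(3)] by blast
  define v where "v = (\<lambda>i. w i + (- (B w w / (2 * B e w))) * e i)"
  have v: "B y v = 0" "B e v = B e w"
    unfolding v_def linear_right using w y by (simp_all add: sym[of y e] isotropic)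
  have "B v v = 0"
    unfolding v_def form_add isotropic sym[of w e] using w by (simp add: field_simps)
  \<comment> \<open>The factor \<open>\<sigma> * B e w\<close> makes the tested quantity
    \<open>t\<close> times a square, so the ray enters the chosen side whatever the sign of
    \<open>B e w\<close>.\<close>
  have "(\<lambda>i. y i + t * (\<sigma> * B e w) * v i) \<in> side \<sigma>" if "t > 0" for t
  proof -
    have "t * (\<sigma> * B e w)\<^sup>2 > 0" using that assms w by simp
    then show ?thesis
      unfolding side_def mem_Collect_eq form_add linear_right using y v \<open>B v v = 0\<close>
      by (simp add: power2_eq_square ac_simps)
  qed
  then show "y \<in> closure (side \<sigma>)"
    by (intro ray_in_closure[of y "\<lambda>i. \<sigma> * B e w * v i"]) (simp add: mult.assoc)
qed

lemma connected_null_cone_minus_proportional: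
  assumes "wall \<noteq> {}"
  shows "connected {y. B y y = 0 \<and> \<not> proportional y}"
proof -
  have "connected (side \<sigma> \<union> wall)" if "\<sigma> \<noteq> 0" for \<sigma>
    using wall_subset_closure_side[OF that] closure_subset
    by (intro connected_intermediate_closure[OF connected_side]) auto
  then have "connected ((side 1 \<union> wall) \<union> (side (- 1) \<union> wall))"
    using assms by (intro connected_Un[of "side 1 \<union> wall"]) auto
  moreover have "\<not> proportional y" if "B e y \<noteq> 0" for y
    using that isotropic sym[of y e] unfolding proportional_def by (metis mult_zero_right)
  then have "(side 1 \<union> wall) \<union> (side (- 1) \<union> wall) = {y. B y y = 0 \<and> \<not> proportional y}"
    by (auto simp: side_def wall_def)
  ultimately show ?thesis by (simp only:)
qed

text \<open>Puts back the vectors equivalent to nonzero multiples of \<open>e\<close>. Each is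
  orthogonal to a wall vector \<open>u\<close>, so adding a small multiple of \<open>u\<close> keeps
  it null and destroys proportionality.\<close>

lemma connected_null_cone_minus_radical:
  assumes "wall \<noteq> {}"
  shows "connected {y. B y y = 0 \<and> (\<exists>w. B y w \<noteq> 0)}"
proof (rule connected_intermediate_closure[OF connected_null_cone_minus_proportional[OF assms]])
  show "{y. B y y = 0 \<and> \<not> proportional y} \<subseteq> {y. B y y = 0 \<and> (\<exists>w. B y w \<noteq> 0)}"
  proof (intro Collect_mono impI conjI)
    fix y assume y: "B y y = 0 \<and> \<not> proportional y"
    then show "B y y = 0" by simp
    from y have "\<not> (\<forall>w. B y w = 0 * B e w)" unfolding proportional_def by blast
    then show "\<exists>w. B y w \<noteq> 0" by simp
  qed
  obtain u where u: "B u u = 0" "B e u = 0" "\<not> proportional u"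
    using assms by (auto simp: wall_def)
  show "{y. B y y = 0 \<and> (\<exists>w. B y w \<noteq> 0)} \<subseteq> closure {y. B y y = 0 \<and> \<not> proportional y}"
  proof
    fix y assume "y \<in> {y. B y y = 0 \<and> (\<exists>w. B y w \<noteq> 0)}"
    then have y: "B y y = 0" by simp
    show "y \<in> closure {y. B y y = 0 \<and> \<not> proportional y}"
    proof (cases "proportional y")
      case True
      then obtain c where c: "\<And>w. B y w = c * B e w" by (auto simp: proportional_def)
      show ?thesis
      proof (rule ray_in_closure)
        fix t :: real assume t: "t > 0"
        have "\<not> proportional (\<lambda>i. y i + t * u i)"
        proof
          assume "proportional (\<lambda>i. y i + t * u i)"
          then obtain d where d: "\<And>w. B y w + t * B u w = d * B e w"
            by (auto simp: proportional_def linear)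
          then have "B u w = ((d - c) / t) * B e w" for w
            using t c[of w] d[of w] by (simp add: field_simps)
          then show False using u(3) unfolding proportional_def by blast
        qed
        then show "(\<lambda>i. y i + t * u i) \<in> {y. B y y = 0 \<and> \<not> proportional y}"
          using y u c by (simp add: form_add)
      qed
    next
      case False
      then show ?thesis using y by (intro subsetD[OF closure_subset]) simp
    qed
  qed
qed

end

section \<open>The polar form of \<open>Psi\<close>\<close>

text \<open>Averaging the two mixed products makes the symmetry hold term by term.\<close>

definition Psi_polar :: "nat \<Rightarrow> (nat \<Rightarrow> real) \<Rightarrow> (nat \<Rightarrow> real) \<Rightarrow> real" where
  "Psi_polar n x y =
     (1 / 2 ^ (n - 1) * (\<Sum>k = 0..n - 1. real ((n - 1) choose k) * x (k + 1))) *
     (1 / 2 ^ (n - 1) * (\<Sum>k = 0..n - 1. real ((n - 1) choose k) * y (k + 1)))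
     - 1 / 2 ^ (n - 1) *
         (\<Sum>k = 0..n - 2. real ((n - 2) choose k) *
            (x (k + 2) * y (k + 2)
             + (x (k + 1) * y (n - (k + 1)) + y (k + 1) * x (n - (k + 1))) / 2))"

lemma Psi_eq_Psi_polar: "Psi n x = Psi_polar n x x"
  by (simp add: Psi_def Psi_polar_def power2_eq_square)

lemma Psi_polar_sym: "Psi_polar n x y = Psi_polar n y x"
  by (simp add: Psi_polar_def algebra_simps)

lemma Psi_polar_linear: "Psi_polar n (\<lambda>i. x i + t * y i) z = Psi_polar n x z + t * Psi_polar n y z"
proof -
  have 1: "(\<Sum>k = 0..n - 1. real ((n - 1) choose k) * (x (k + 1) + t * y (k + 1))) =
    (\<Sum>k = 0..n - 1. real ((n - 1) choose k) * x (k + 1)) +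
    t * (\<Sum>k = 0..n - 1. real ((n - 1) choose k) * y (k + 1))"
    by (simp add: sum_distrib_left flip: sum.distrib) (simp add: algebra_simps)
  have 2: "(\<Sum>k = 0..n - 2. real ((n - 2) choose k) * ((x (k + 2) + t * y (k + 2)) * z (k + 2)
      + ((x (k + 1) + t * y (k + 1)) * z (n - (k + 1))
         + z (k + 1) * (x (n - (k + 1)) + t * y (n - (k + 1)))) / 2)) =
    (\<Sum>k = 0..n - 2. real ((n - 2) choose k) * (x (k + 2) * z (k + 2)
      + (x (k + 1) * z (n - (k + 1)) + z (k + 1) * x (n - (k + 1))) / 2)) +
    t * (\<Sum>k = 0..n - 2. real ((n - 2) choose k) * (y (k + 2) * z (k + 2)
      + (y (k + 1) * z (n - (k + 1)) + z (k + 1) * y (n - (k + 1))) / 2))"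
    unfolding sum_distrib_left sum.distrib[symmetric]
    by (intro sum.cong) (auto simp: field_simps)
  show ?thesis unfolding Psi_polar_def 1 2 by (simp only: algebra_simps)
qed

lemma continuous_on_Psi_polar:
  assumes "\<And>i. continuous_on S (\<lambda>x. f x i)" "\<And>i. continuous_on S (\<lambda>x. g x i)"
  shows "continuous_on S (\<lambda>x. Psi_polar n (f x) (g x))"
  unfolding Psi_polar_def by (intro continuous_intros assms) auto

lemma isotropic_form_Psi_polar:
  assumes "Psi_polar n e e = 0" "\<exists>w. Psi_polar n e w \<noteq> 0"
  shows "isotropic_form (Psi_polar n) e"
  using assms
  by unfold_locales (auto simp: Psi_polar_linear intro: Psi_polar_sym intro!: continuous_on_Psi_polar)

lemma Psi_cong:
  assumes "n \<ge> 2" "\<And>i. i \<in> {1..n} \<Longrightarrow> x i = y i"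
  shows "Psi n x = Psi n y"
  unfolding Psi_def using assms
  by (intro arg_cong2[of _ _ _ _ "(-)"] arg_cong[of _ _ "\<lambda>s. s\<^sup>2"] arg_cong2[of _ _ _ _ "(*)"]
      arg_cong2[of _ _ _ _ "(+)"] sum.cong refl) auto

section \<open>Retraction of the cone onto the cube\<close>

lemma continuous_on_Max:
  fixes f :: "'i \<Rightarrow> 'a::topological_space \<Rightarrow> real"
  assumes "finite I" "I \<noteq> {}" "\<And>i. i \<in> I \<Longrightarrow> continuous_on S (f i)"
  shows "continuous_on S (\<lambda>x. Max ((\<lambda>i. f i x) ` I))"
  using assms by (induction I rule: finite_ne_induct) (auto intro!: continuous_intros)

text \<open>Coordinates outside \<open>{1..n}\<close> are left free; for \<open>n \<ge> 2\<close>
  they do not enter \<open>Psi\<close>.\<close>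

definition Infl_cone :: "nat \<Rightarrow> (nat \<Rightarrow> real) set" where
  "Infl_cone n = {y. Psi n y = 0 \<and> (\<exists>s\<in>{1..n}. y s \<noteq> y (n - s + 1))}"

text \<open>Constants lie in the radical of the quadratic form, so after moving the centre of the cube
  to the origin its zero set is a cone, which radial clamping retracts onto the cube.\<close>

lemma connectedin_GST_if_connected_cone:
  assumes n: "n \<ge> 2" and const: "\<And>y. Psi_polar n (\<lambda>_. 1) y = 0"
    and conn: "connected (Infl_cone n)"
  shows "connectedin (powertop_real {1..n}) (GST n)"
proof -
  \<comment> \<open>\<open>m y = 1\<close> once all coordinates are at most \<open>1 / 2\<close> in
    absolute value, so \<open>G\<close> merely translates the centred cube and shrinks other points
    radially to its boundary.\<close>
  define m where "m = (\<lambda>y. max 1 (2 * Max ((\<lambda>i. \<bar>y i\<bar>) ` {1..n})) :: real)"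
  define G where "G = (\<lambda>y. restrict (\<lambda>i. 1 / 2 + 1 / m y * y i) {1..n})"
  \<comment> \<open>A constant in the radical drops out of each argument of the polar form, leaving
    only the quadratic term.\<close>
  have affine: "Psi n (\<lambda>i. c + t * y i) = t\<^sup>2 * Psi n y" for c t y
  proof -
    have shift: "Psi_polar n (\<lambda>i. c + t * x i) z = t * Psi_polar n x z" for x z
    proof -
      have "Psi_polar n (\<lambda>i. c + t * x i) z = Psi_polar n (\<lambda>i. 0 + c * 1) z + t * Psi_polar n x z"
        using Psi_polar_linear[of n "\<lambda>_. c" t x z] by simp
      also have "Psi_polar n (\<lambda>i. 0 + c * 1) z = 0"
        unfolding Psi_polar_linear const by (simp add: Psi_polar_def)
      finally show ?thesis by simp
    qed
    have "Psi n (\<lambda>i. c + t * y i) = t * Psi_polar n y (\<lambda>i. c + t * y i)"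
      by (simp only: Psi_eq_Psi_polar shift)
    also have "Psi_polar n y (\<lambda>i. c + t * y i) = t * Psi_polar n y y"
      by (subst Psi_polar_sym) (rule shift)
    finally show ?thesis by (simp add: Psi_eq_Psi_polar power2_eq_square)
  qed
  have m_pos: "m y > 0" for y by (simp add: m_def)
  have bound: "\<bar>1 / m y * y i\<bar> \<le> 1 / 2" if "i \<in> {1..n}" for y i
  proof -
    have "\<bar>y i\<bar> \<le> Max ((\<lambda>i. \<bar>y i\<bar>) ` {1..n})" using that by (intro Max_ge) auto
    then have "2 * \<bar>y i\<bar> \<le> m y" by (simp add: m_def)
    then show ?thesis using m_pos[of y] by (simp add: abs_mult field_simps)
  qed
  have cont_m: "continuous_on UNIV m"
    unfolding m_def using n by (intro continuous_intros continuous_on_Max) auto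
  have "continuous_map euclidean (powertop_real {1..n}) G"
    unfolding continuous_map_componentwise
  proof (intro conjI ballI)
    show "G ` topspace euclidean \<subseteq> extensional {1..n}" by (auto simp: G_def)
    fix k assume k: "k \<in> {1..n}"
    have "continuous_on UNIV (\<lambda>y. 1 / 2 + 1 / m y * y k)"
      using m_pos by (intro continuous_intros cont_m) (auto simp: less_le)
    then show "continuous_map euclidean euclideanreal (\<lambda>y. G y k)"
      using k by (simp add: G_def)
  qed
  then have "connectedin (powertop_real {1..n}) (G ` Infl_cone n)"
    by (rule connectedin_continuous_map_image) (simp add: conn)
  moreover have "G ` Infl_cone n = GST n"
  proof (intro equalityI subsetI)
    fix x assume "x \<in> G ` Infl_cone n"
    then obtain y s where y: "x = G y" "Psi n y = 0" "s \<in> {1..n}" "y s \<noteq> y (n - s + 1)"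
      by (auto simp: Infl_cone_def)
    have "Psi n x = Psi n (\<lambda>i. 1 / 2 + 1 / m y * y i)"
      unfolding y G_def by (intro Psi_cong n) auto
    then have "Psi n x = 0" by (simp only: affine y(2))
    moreover have "x i \<in> {0..1}" if "i \<in> {1..n}" for i
    proof -
      have "x i = 1 / 2 + 1 / m y * y i" using that by (simp add: y(1) G_def)
      then show ?thesis
        using bound[OF that, of y] unfolding abs_le_iff atLeastAtMost_iff by linarith
    qed
    then have "x \<in> unit_cube n" unfolding unit_cube_def by (auto simp: PiE_iff y(1) G_def)
    moreover have "n - s + 1 \<in> {1..n}" using y(3) by auto
    then have "x s \<noteq> x (n - s + 1)" using y(3,4) m_pos[of y] by (simp add: y(1) G_def)
    ultimately show "x \<in> GST n" using y(3) unfolding GST_def Ind_def Infl_def by blast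
  next
    fix x assume x: "x \<in> GST n"
    then have cube: "x \<in> unit_cube n" and zero: "Psi n x = 0" by (auto simp: GST_def Ind_def)
    define y where "y = (\<lambda>i. - 1 / 2 + 1 * x i)"
    have "Psi n y = 0" unfolding y_def affine using zero by simp
    then have "y \<in> Infl_cone n" using x by (auto simp: Infl_cone_def GST_def Infl_def y_def)
    moreover have "\<bar>y i\<bar> \<le> 1 / 2" if "i \<in> {1..n}" for i
    proof -
      have "x i \<in> {0..1}" using cube that unfolding unit_cube_def by (rule PiE_mem)
      then show ?thesis unfolding y_def abs_le_iff atLeastAtMost_iff by linarith
    qed
    then have "Max ((\<lambda>i. \<bar>y i\<bar>) ` {1..n}) \<le> 1 / 2" using n by (subst Max_le_iff) auto
    then have "m y = 1" by (simp add: m_def)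
    then have "G y = restrict x {1..n}" by (auto simp: G_def y_def)
    then have "G y = x" using cube unfolding unit_cube_def by (metis PiE_restrict)
    ultimately show "x \<in> G ` Infl_cone n" by blast
  qed
  ultimately show ?thesis by simp
qed

section \<open>Explicit forms and the cases 5, 6, 7\<close>

text \<open>The factor \<open>4 ^ (n - 1)\<close> clears denominators; the mixed terms for
  \<open>k\<close> and \<open>n - 2 - k\<close> coincide and are merged.\<close>

lemma Psi_polar_5:
  "256 * Psi_polar 5 x y =
     (x 1 + 4 * x 2 + 6 * x 3 + 4 * x 4 + x 5) * (y 1 + 4 * y 2 + 6 * y 3 + 4 * y 4 + y 5)
     - 16 * (x 2 * y 2 + 3 * (x 3 * y 3) + 3 * (x 4 * y 4) + x 5 * y 5
       + (x 1 * y 4 + x 4 * y 1) + 3 * (x 2 * y 3 + x 3 * y 2))"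
  by (simp add: Psi_polar_def eval_nat_numeral) (simp add: field_simps)

lemma Psi_polar_6:
  "1024 * Psi_polar 6 x y =
     (x 1 + 5 * x 2 + 10 * x 3 + 10 * x 4 + 5 * x 5 + x 6) *
     (y 1 + 5 * y 2 + 10 * y 3 + 10 * y 4 + 5 * y 5 + y 6)
     - 32 * (x 2 * y 2 + 4 * (x 3 * y 3) + 6 * (x 4 * y 4) + 4 * (x 5 * y 5) + x 6 * y 6
       + (x 1 * y 5 + x 5 * y 1) + 4 * (x 2 * y 4 + x 4 * y 2) + 6 * (x 3 * y 3))"
  by (simp add: Psi_polar_def eval_nat_numeral) (simp add: field_simps)

lemma Psi_polar_7:
  "4096 * Psi_polar 7 x y =
     (x 1 + 6 * x 2 + 15 * x 3 + 20 * x 4 + 15 * x 5 + 6 * x 6 + x 7) *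
     (y 1 + 6 * y 2 + 15 * y 3 + 20 * y 4 + 15 * y 5 + 6 * y 6 + y 7)
     - 64 * (x 2 * y 2 + 5 * (x 3 * y 3) + 10 * (x 4 * y 4) + 10 * (x 5 * y 5) + 5 * (x 6 * y 6)
       + x 7 * y 7 + (x 1 * y 6 + x 6 * y 1) + 5 * (x 2 * y 5 + x 5 * y 2)
       + 10 * (x 3 * y 4 + x 4 * y 3))"
  by (simp add: Psi_polar_def eval_nat_numeral) (simp add: field_simps)

text \<open>On symmetric vectors \<open>Psi\<close> is \<open>- 1 / 4\<close> times the variance of \<open>y (K + 1) + y (K + 2)\<close>, where
  \<open>K\<close> is binomial with parameters \<open>n - 2\<close> and \<open>1 / 2\<close>; this is the source of the sums of squares below.
  For odd \<open>n\<close> the alternating vector has variance zero and serves as \<open>e\<close>. For \<open>n = 6\<close> only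
  constants do, so \<open>e\<close> has to be non-symmetric and its multiples belong to the cone.\<close>

lemma Infl_cone_5: "Infl_cone 5 = {y. Psi_polar 5 y y = 0 \<and> (y 1 \<noteq> y 5 \<or> y 2 \<noteq> y 4)}"
proof -
  have "{1..5::nat} = {1, 2, 3, 4, 5}" by auto
  then show ?thesis by (auto simp: Infl_cone_def Psi_eq_Psi_polar simp flip: numeral_2_eq_2)
qed

lemma connected_Infl_cone_5: "connected (Infl_cone 5)"
proof -
  define e :: "nat \<Rightarrow> real" where "e = (\<lambda>i. (- 1) ^ i)"
  define b :: "nat \<Rightarrow> nat \<Rightarrow> real" where "b = (\<lambda>j i. if i = j then 1 else 0)"
  have "Psi_polar 5 e e = 0" using Psi_polar_5[of e e] by (simp add: e_def)
  moreover have "Psi_polar 5 e (b 1) \<noteq> 0"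
    using Psi_polar_5[of e "b 1"] by (auto simp: e_def b_def)
  ultimately interpret isotropic_form "Psi_polar 5" e
    by (intro isotropic_form_Psi_polar) auto
  have coords: "y 3 = y 1 \<and> y 4 = y 2 \<and> y 5 = y 3"
    if c: "\<forall>w. Psi_polar 5 y w = c * Psi_polar 5 e w" for y c
  proof -
    \<comment> \<open>Testing against the unit vectors turns proportionality into a linear
      system.\<close>
    have "256 * Psi_polar 5 y (b j) = c * (256 * Psi_polar 5 e (b j))" for j using c by simp
    note eqs = this[unfolded Psi_polar_5, unfolded b_def e_def]
    show ?thesis
      using eqs[of 1, simplified] eqs[of 2, simplified] eqs[of 3, simplified]
        eqs[of 4, simplified] eqs[of 5, simplified]
      by (intro conjI; simp add: e_def)
  qed
  have prop_sym: "y 1 = y 5 \<and> y 2 = y 4" if "proportional y" for y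
    using that coords unfolding proportional_def by metis
  have sym_prop: "proportional y"
    if "Psi_polar 5 y y = 0" "y 1 = y 5 \<and> y 2 = y 4" for y
  proof -
    have "256 * Psi_polar 5 y y = - (12 * (y 1 - y 3)\<^sup>2)"
      unfolding Psi_polar_5 using that(2) by (simp add: power2_eq_square algebra_simps)
    then have "(y 1 - y 3)\<^sup>2 = 0"
      using that(1) zero_le_power2[of "y 1 - y 3"] by linarith+
    then have y: "y 3 = y 1" "y 4 = y 2" "y 5 = y 1" using that(2) by auto
    \<comment> \<open>As \<open>e\<close> alternates between \<open>- 1\<close> and
      \<open>1\<close>, \<open>y\<close> is the constant \<open>(y 1 + y 2) / 2\<close> plus this
      multiple of \<open>e\<close>.\<close>
    have "256 * Psi_polar 5 y w = ((y 2 - y 1) / 2) * (256 * Psi_polar 5 e w)" for w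
      unfolding Psi_polar_5 y e_def by (simp add: field_simps)
    then have "Psi_polar 5 y w = ((y 2 - y 1) / 2) * Psi_polar 5 e w" for w
      by (simp add: mult.commute)
    then show ?thesis unfolding proportional_def by blast
  qed
  have "Infl_cone 5 = {y. Psi_polar 5 y y = 0 \<and> \<not> proportional y}"
    unfolding Infl_cone_5 using prop_sym sym_prop by blast
  moreover have "wall \<noteq> {}"
  proof -
    \<comment> \<open>Orthogonality to \<open>e\<close> reads
      \<open>u 1 - 2 * u 2 + 2 * u 4 - u 5 = 0\<close>. With the entries 6, 3 and zeros fixed,
      nullity becomes \<open>t^2 + 6 * t - 15 = 0\<close> for \<open>t = u 3\<close>.\<close>
    define u :: "nat \<Rightarrow> real" where "u = (\<lambda>_. 0)(1 := 6, 2 := 3, 3 := 2 * sqrt 6 - 3)"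
    have sqrt6: "sqrt 6 * (sqrt 6 * a) = 6 * a" for a :: real by (simp flip: mult.assoc)
    have "Psi_polar 5 u u = 0"
      using Psi_polar_5[of u u] by (simp add: u_def algebra_simps sqrt6)
    moreover have "Psi_polar 5 e u = 0"
      using Psi_polar_5[of e u] by (simp add: u_def e_def)
    moreover have "\<not> proportional u"
      using prop_sym[of u] by (auto simp: u_def)
    ultimately show ?thesis unfolding wall_def by blast
  qed
  ultimately show ?thesis using connected_null_cone_minus_proportional by simp
qed

lemma Infl_cone_6:
  "Infl_cone 6 = {y. Psi_polar 6 y y = 0 \<and> (y 1 \<noteq> y 6 \<or> y 2 \<noteq> y 5 \<or> y 3 \<noteq> y 4)}"
proof -
  have "{1..6::nat} = {1, 2, 3, 4, 5, 6}" by auto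
  then show ?thesis by (auto simp: Infl_cone_def Psi_eq_Psi_polar simp flip: numeral_2_eq_2)
qed

lemma connected_Infl_cone_6: "connected (Infl_cone 6)"
proof -
  \<comment> \<open>Null because its binomially weighted sum is 24 and
    \<open>24^2 = 32 * 18\<close>.\<close>
  define e :: "nat \<Rightarrow> real" where "e = (\<lambda>_. 0)(1 := - 1, 3 := 1, 4 := 1, 5 := 1)"
  define b :: "nat \<Rightarrow> nat \<Rightarrow> real" where "b = (\<lambda>j i. if i = j then 1 else 0)"
  have "Psi_polar 6 e e = 0" using Psi_polar_6[of e e] by (simp add: e_def)
  moreover have "Psi_polar 6 e (b 1) \<noteq> 0"
    using Psi_polar_6[of e "b 1"] by (auto simp: e_def b_def)
  ultimately interpret isotropic_form "Psi_polar 6" e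
    by (intro isotropic_form_Psi_polar) auto
  have coords: "y 2 = y 1 + c * (e 2 - e 1) \<and> y 3 = y 2 + c * (e 3 - e 2) \<and>
      y 4 = y 3 + c * (e 4 - e 3) \<and> y 5 = y 4 + c * (e 5 - e 4) \<and> y 6 = y 5 + c * (e 6 - e 5)"
    if c: "\<forall>w. Psi_polar 6 y w = c * Psi_polar 6 e w" for y c
  proof -
    have "1024 * Psi_polar 6 y (b j) = c * (1024 * Psi_polar 6 e (b j))" for j using c by simp
    note eqs = this[unfolded Psi_polar_6, unfolded b_def e_def]
    show ?thesis
      using eqs[of 1, simplified] eqs[of 2, simplified] eqs[of 3, simplified]
        eqs[of 4, simplified] eqs[of 5, simplified] eqs[of 6, simplified]
      by (intro conjI; simp add: e_def)
  qed
  have rad_sym: "y 1 = y 6 \<and> y 2 = y 5 \<and> y 3 = y 4" if "\<forall>w. Psi_polar 6 y w = 0" for y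
    using coords[of y 0] that by simp
  have sym_rad: "Psi_polar 6 y w = 0"
    if "Psi_polar 6 y y = 0" "y 1 = y 6 \<and> y 2 = y 5 \<and> y 3 = y 4" for y w
  proof -
    \<comment> \<open>The variance as a sum over pairs of values: \<open>y 1 + y 2\<close>,
      \<open>y 2 + y 3\<close>, \<open>2 * y 3\<close> have weights 2, 8, 6 out of 16, whence the
      coefficients \<open>2 * 8\<close>, \<open>2 * 6\<close>, \<open>8 * 6\<close>.\<close>
    have "1024 * Psi_polar 6 y y = - (16 * (y 1 - y 3)\<^sup>2
        + 12 * (y 1 + y 2 - 2 * y 3)\<^sup>2 + 48 * (y 2 - y 3)\<^sup>2)"
      unfolding Psi_polar_6 using that(2) by (simp add: power2_eq_square algebra_simps)
    then have "(y 1 - y 3)\<^sup>2 = 0" "(y 2 - y 3)\<^sup>2 = 0"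
      using that(1) zero_le_power2[of "y 1 - y 3"] zero_le_power2[of "y 1 + y 2 - 2 * y 3"]
        zero_le_power2[of "y 2 - y 3"] by linarith+
    then have y: "y 2 = y 1" "y 3 = y 1" "y 4 = y 1" "y 5 = y 1" "y 6 = y 1" using that(2) by auto
    have "1024 * Psi_polar 6 y w = 0"
      unfolding Psi_polar_6 y by (simp add: algebra_simps)
    then show ?thesis by simp
  qed
  \<comment> \<open>Here the symmetric null vectors are exactly the radical.\<close>
  have "Infl_cone 6 = {y. Psi_polar 6 y y = 0 \<and> (\<exists>w. Psi_polar 6 y w \<noteq> 0)}"
    unfolding Infl_cone_6 using rad_sym sym_rad by blast
  moreover have "wall \<noteq> {}"
  proof -
    \<comment> \<open>Spans a plane of null vectors with \<open>e\<close>; both have sixth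
      coordinate 0, so no nonzero combination is constant on \<open>{1..6}\<close>.\<close>
    define u :: "nat \<Rightarrow> real" where "u = (\<lambda>_. 0)(1 := 1, 2 := - 2, 3 := 1, 4 := 2, 5 := - 1)"
    have "Psi_polar 6 u u = 0"
      using Psi_polar_6[of u u] by (simp add: u_def algebra_simps)
    moreover have "Psi_polar 6 e u = 0"
      using Psi_polar_6[of e u] by (simp add: u_def e_def)
    moreover have "\<not> proportional u"
    proof
      assume "proportional u"
      then obtain c where "\<forall>w. Psi_polar 6 u w = c * Psi_polar 6 e w"
        by (auto simp: proportional_def)
      from coords[OF this] show False by (simp add: e_def u_def)
    qed
    ultimately show ?thesis unfolding wall_def by blast
  qed
  ultimately show ?thesis using connected_null_cone_minus_radical by simp
qed

lemma Infl_cone_7: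
  "Infl_cone 7 = {y. Psi_polar 7 y y = 0 \<and> (y 1 \<noteq> y 7 \<or> y 2 \<noteq> y 6 \<or> y 3 \<noteq> y 5)}"
proof -
  have "{1..7::nat} = {1, 2, 3, 4, 5, 6, 7}" by auto
  then show ?thesis by (auto simp: Infl_cone_def Psi_eq_Psi_polar simp flip: numeral_2_eq_2)
qed

lemma connected_Infl_cone_7: "connected (Infl_cone 7)"
proof -
  define e :: "nat \<Rightarrow> real" where "e = (\<lambda>i. (- 1) ^ i)"
  define b :: "nat \<Rightarrow> nat \<Rightarrow> real" where "b = (\<lambda>j i. if i = j then 1 else 0)"
  have "Psi_polar 7 e e = 0" using Psi_polar_7[of e e] by (simp add: e_def)
  moreover have "Psi_polar 7 e (b 1) \<noteq> 0"
    using Psi_polar_7[of e "b 1"] by (auto simp: e_def b_def)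
  ultimately interpret isotropic_form "Psi_polar 7" e
    by (intro isotropic_form_Psi_polar) auto
  have coords: "y 3 = y 1 \<and> y 4 = y 2 \<and> y 5 = y 3 \<and> y 6 = y 4 \<and> y 7 = y 5"
    if c: "\<forall>w. Psi_polar 7 y w = c * Psi_polar 7 e w" for y c
  proof -
    have "4096 * Psi_polar 7 y (b j) = c * (4096 * Psi_polar 7 e (b j))" for j using c by simp
    note eqs = this[unfolded Psi_polar_7, unfolded b_def e_def]
    show ?thesis
      using eqs[of 1, simplified] eqs[of 2, simplified] eqs[of 3, simplified]
        eqs[of 4, simplified] eqs[of 5, simplified] eqs[of 6, simplified]
        eqs[of 7, simplified]
      by (intro conjI; simp add: e_def)
  qed
  have prop_sym: "y 1 = y 7 \<and> y 2 = y 6 \<and> y 3 = y 5" if "proportional y" for y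
    using that coords unfolding proportional_def by metis
  have sym_prop: "proportional y"
    if "Psi_polar 7 y y = 0" "y 1 = y 7 \<and> y 2 = y 6 \<and> y 3 = y 5" for y
  proof -
    \<comment> \<open>The same pairwise variance, with weights 2, 10, 20 out of 32.\<close>
    have "4096 * Psi_polar 7 y y = - (20 * (y 1 - y 3)\<^sup>2
        + 40 * (y 1 + y 2 - y 3 - y 4)\<^sup>2 + 200 * (y 2 - y 4)\<^sup>2)"
      unfolding Psi_polar_7 using that(2) by (simp add: power2_eq_square algebra_simps)
    then have "(y 1 - y 3)\<^sup>2 = 0" "(y 2 - y 4)\<^sup>2 = 0"
      using that(1) zero_le_power2[of "y 1 - y 3"] zero_le_power2[of "y 1 + y 2 - y 3 - y 4"]
        zero_le_power2[of "y 2 - y 4"] by linarith+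
    then have y: "y 3 = y 1" "y 4 = y 2" "y 5 = y 1" "y 6 = y 2" "y 7 = y 1" using that(2) by auto
    have "4096 * Psi_polar 7 y w = ((y 2 - y 1) / 2) * (4096 * Psi_polar 7 e w)" for w
      unfolding Psi_polar_7 y e_def by (simp add: field_simps)
    then have "Psi_polar 7 y w = ((y 2 - y 1) / 2) * Psi_polar 7 e w" for w
      by (simp add: mult.commute)
    then show ?thesis unfolding proportional_def by blast
  qed
  have "Infl_cone 7 = {y. Psi_polar 7 y y = 0 \<and> \<not> proportional y}"
    unfolding Infl_cone_7 using prop_sym sym_prop by blast
  moreover have "wall \<noteq> {}"
  proof -
    \<comment> \<open>On the support \<open>{1, 4, 5}\<close> orthogonality to \<open>e\<close>
      means \<open>u 1 = 5 * u 5\<close>; with \<open>u 5 = 1\<close>, nullity is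
      \<open>3 * t^2 - 10 * t + 3 = 0\<close> for \<open>t = u 4\<close>, with root 3.\<close>
    define u :: "nat \<Rightarrow> real" where "u = (\<lambda>_. 0)(1 := 5, 4 := 3, 5 := 1)"
    have "Psi_polar 7 u u = 0"
      using Psi_polar_7[of u u] by (simp add: u_def algebra_simps)
    moreover have "Psi_polar 7 e u = 0"
      using Psi_polar_7[of e u] by (simp add: u_def e_def)
    moreover have "\<not> proportional u"
      using prop_sym[of u] by (auto simp: u_def)
    ultimately show ?thesis unfolding wall_def by blast
  qed
  ultimately show ?thesis using connected_null_cone_minus_proportional by simp
qed

theorem mainTheorem1:
  fixes n :: nat
  assumes "n \<in> {5, 6, 7}"
  shows "connectedin (powertop_real {1..n}) (GST n)"
proof (rule connectedin_GST_if_connected_cone)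
  show "n \<ge> 2" using assms by auto
  show "Psi_polar n (\<lambda>_. 1) y = 0" for y
    using assms Psi_polar_5[of "\<lambda>_. 1" y] Psi_polar_6[of "\<lambda>_. 1" y]
      Psi_polar_7[of "\<lambda>_. 1" y] by auto
  show "connected (Infl_cone n)"
    using assms connected_Infl_cone_5 connected_Infl_cone_6 connected_Infl_cone_7 by auto
qed

end
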